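(* Let $B=B[0]$ be an $n\times n$ skew-symmetrizable integer matrix with skew-symmetrizer $D=\mathrm{diag}(d_1,\dots,d_n)$, let $k_0,\dots,k_{T-1}\in\{1,\dots,n\}$, let $\varepsilon_0,\dots,\varepsilon_{T-1}$ be the associated tropical sign sequence, and consider the sequence of signed mutations $$(u[0],p[0])\overset{\mu^{B[0]}_{k_0,\varepsilon_0}}{\mapsto}(u[1],p[1])\overset{\mu^{B[1]}_{k_1,\varepsilon_1}}{\mapsto}\cdots\overset{\mu^{B[T-1]}_{k_{T-1},\varepsilon_{T-1}}}{\mapsto}(u[T],p[T])$$ on $\mathbb{R}^{2n}$. For each $s=0,\dots,T-1$, the value of the Lagrangian $\mathscr{L}[s]$ along a Hamiltonian flow is constant in $t$ in the time span $[s,s+1]$. Thus the action integral $S$ along the flow satisfies $$S=\sum_{s=0}^{T-1}\mathscr{L}[s],$$ where $\mathscr{L}[s]$ on the right denotes the constant value on $[s,s+1]$.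
   Context: Signs $\pm$ are identified with $\pm1$; $[a]_+=\max(a,0)$. $D$ (positive integers $d_i$) is a skew-symmetrizer of $B$ if $d_ib_{ij}=-d_jb_{ji}$. Matrix mutation $B\mapsto B'=\mu_k(B)$: $b'_{ij}=-b_{ij}$ if $i=k$ or $j=k$, else $b'_{ij}=b_{ij}+[-\varepsilon b_{ik}]_+b_{kj}+b_{ik}[\varepsilon b_{kj}]_+$ (independent of $\varepsilon$). $B[s+1]=\mu_{k_s}(B[s])$; $D$ is a common skew-symmetrizer of all $B[s]$. Tropical sign sequence: Let $\mathbb{Q}_+(y)$ be the semifield of subtraction-free rational functions in formal variables $y=(y_1,\dots,y_n)$ (quotients of nonzero polynomials with nonnegative integer coefficients). Put $y[0]=y$ and let $y[s+1]$ be obtained from $y[s]$ by $y'_{k}=y_{k}^{-1}$, $y'_i=y_iy_k^{[\varepsilon b_{ki}]_+}(1+y_k^{\varepsilon})^{-b_{ki}}$ ($i\ne k$) with $k=k_s$, $B=B[s]$. Let $\pi_{\mathrm{trop}}$ be the semifield homomorphism, $y_i\mapsto y_i$, from $\mathbb{Q}_+(y)$ to the semifield $\mathrm{Trop}(y)$ of Laurent monomials in $y$ with addition $\prod y_i^{a_i}\oplus\prod y_i^{b_i}=\prod y_i^{\min(a_i,b_i)}$. It is known that the exponent vector of $\pi_{\mathrm{trop}}(y_i[s])$ is nonzero with entries all nonnegative or all nonpositive; $\varepsilon_s=+$ or $-$ accordingly for $i=k_s$. Signed mutations: for $(u,p)\in\mathbb{R}^{2n}$ and a matrix $B$ put $w_i=\sum_jb_{ji}u_j$,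 $y_i=e^{d_ip_i+w_i}$, and $H^B_{k,\varepsilon}=\frac{\varepsilon}{2d_k}\mathrm{Li}_2(-y_k^{\varepsilon})$, with $\mathrm{Li}_2(-x)=-\int_0^x\frac{\log(1+z)}{z}dz$. $\rho^B_{k,\varepsilon}$ is the time one flow of $\dot u_i=\partial H/\partial p_i$, $\dot p_i=-\partial H/\partial u_i$ with $H=H^B_{k,\varepsilon}$; $\tau^B_{k,\varepsilon}:(u,p)\mapsto(u',p')$ is $u'_k=-u_k+\sum_j[-\varepsilon b_{jk}]_+u_j$, $u'_i=u_i$ ($i\neq k$), $p'_k=-p_k$, $p'_i=p_i+[-\varepsilon b_{ik}]_+p_k$ ($i\ne k$); $\mu^B_{k,\varepsilon}=\tau^B_{k,\varepsilon}\circ\rho^B_{k,\varepsilon}$. Hamiltonian flow from time $0$ to $T$: given an arbitrary initial point $(u[0],p[0])$, during $[s,s+1]$ the flow, in the $s$-th canonical coordinates, starts at $(u[s],p[s])$ at time $s$ and follows Hamilton's equations for $H[s]=H^{B[s]}_{k_s,\varepsilon_s}=\frac{\varepsilon_s}{2d_{k_s}}\mathrm{Li}_2(-y_{k_s}[s]^{\varepsilon_s})$; at time $s+1$ one passes to the $(s+1)$-st coordinates by $\tau^{B[s]}_{k_s,\varepsilon_s}$, reaching $(u[s+1],p[s+1])$. The Lagrangian for $[s,s+1]$ is $\mathscr{L}[s]=\dot u_{k_s}[s]\,p_{k_s}[s]-H[s]$ (with $\dot u_{k_s}[s]=-\frac12\log(1+y_{k_s}[s]^{\varepsilon_s})$).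 The action integral is $S=\sum_{s=0}^{T-1}S[s]$, $S[s]=\int_s^{s+1}\mathscr{L}[s]\,dt$, evaluated along the flow in the $s$-th coordinates. *)

theory Defs
  imports
    "HOL-Analysis.Analysis"
    "HOL-Library.Poly_Mapping"
    "HOL-Computational_Algebra.Fraction_Field"
begin

section \<open>Matrix mutation\<close>

type_synonym 'n int_vec = "int^'n"
type_synonym 'n int_mat = "int^'n^'n"

definition skew_symmetrizer :: "('n \<Rightarrow> int) \<Rightarrow> 'n::finite int_mat \<Rightarrow> bool" where
  "skew_symmetrizer d B \<longleftrightarrow>
     (\<forall>i. 0 < d i) \<and> (\<forall>i j. d i * B $ i $ j = - (d j * B $ j $ i))"

definition pos_part :: "int \<Rightarrow> int" where
  "pos_part a = max a 0"

definition mutate :: "int \<Rightarrow> 'n \<Rightarrow> 'n::finite int_mat \<Rightarrow> 'n int_mat" where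
  "mutate \<epsilon> k B = (\<chi> i j. if i = k \<or> j = k then - (B $ i $ j)
     else B $ i $ j + pos_part (- \<epsilon> * B $ i $ k) * B $ k $ j
            + B $ i $ k * pos_part (\<epsilon> * B $ k $ j))"

lemma mutate_sign_independent: "mutate (- 1) k B = mutate 1 k B"
proof -
  have *: "pos_part a * b + a * pos_part (- b) = pos_part (- a) * b + a * pos_part b" for a b
    by (auto simp: pos_part_def max_def algebra_simps)
  show ?thesis
    using * by (auto simp: mutate_def vec_eq_iff add.assoc)
qed

text \<open>By the preceding lemma the sign chosen here is immaterial.\<close>

primrec B_seq :: "'n::finite int_mat \<Rightarrow> (nat \<Rightarrow> 'n) \<Rightarrow> nat \<Rightarrow> 'n int_mat" where
  "B_seq B k 0 = B"
| "B_seq B k (Suc s) = mutate 1 (k s) (B_seq B k s)"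


section \<open>Subtraction-free rational functions and tropical signs\<close>

text \<open>Polynomials over the integers in variables indexed by \<open>'n\<close>: an exponent vector
  \<open>'n \<Rightarrow>\<^sub>0 nat\<close> is mapped to its coefficient. (The library makes this an integral domain
  for linearly ordered \<open>'n\<close>.)\<close>

type_synonym 'n ipoly = "('n \<Rightarrow>\<^sub>0 nat) \<Rightarrow>\<^sub>0 int"

definition nonneg_polys :: "'n ipoly set" where
  "nonneg_polys = {P. P \<noteq> 0 \<and> (\<forall>m. 0 \<le> Poly_Mapping.lookup P m)}"

definition subtraction_free :: "'n::linorder ipoly fract set" where
  "subtraction_free = {Fract P Q | P Q. P \<in> nonneg_polys \<and> Q \<in> nonneg_polys}"

definition y_var :: "'n::linorder \<Rightarrow> 'n ipoly fract" where
  "y_var i = Fract (Poly_Mapping.single (Poly_Mapping.single i 1) 1) 1"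

definition mutate_y ::
  "int \<Rightarrow> 'n \<Rightarrow> 'n::finite int_mat \<Rightarrow> ('n \<Rightarrow> 'a::field) \<Rightarrow> 'n \<Rightarrow> 'a" where
  "mutate_y \<epsilon> k B y i = (if i = k then inverse (y k)
     else y i * y k powi pos_part (\<epsilon> * B $ k $ i) * (1 + y k powi \<epsilon>) powi (- (B $ k $ i)))"

lemma mutate_y_sign_independent:
  assumes "y k \<noteq> 0"
  shows "mutate_y (- 1) k B y = mutate_y 1 k B y"
proof (rule ext)
  fix i
  let ?b = "B $ k $ i"
  have "1 + inverse (y k) = (1 + y k) * inverse (y k)"
    using assms by (simp add: field_simps)
  hence "(1 + inverse (y k)) powi (- ?b) = (1 + y k) powi (- ?b) * y k powi ?b"
    by (simp add: power_int_mult_distrib power_int_minus power_int_inverse)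
  moreover have "y k powi pos_part (- ?b) * y k powi ?b = y k powi pos_part ?b"
    using assms by (simp add: power_int_add [symmetric] pos_part_def max_def)
  ultimately show "mutate_y (- 1) k B y i = mutate_y 1 k B y i"
    by (simp add: mutate_y_def power_int_minus mult_ac)
qed

primrec y_seq ::
  "'n::{finite,linorder} int_mat \<Rightarrow> (nat \<Rightarrow> 'n) \<Rightarrow> nat \<Rightarrow> 'n \<Rightarrow> 'n ipoly fract" where
  "y_seq B k 0 = y_var"
| "y_seq B k (Suc s) = mutate_y 1 (k s) (B_seq B k s) (y_seq B k s)"

text \<open>A Laurent monomial is represented by its exponent vector, so multiplication in
  \<open>Trop(y)\<close> is vector addition and addition in \<open>Trop(y)\<close> is the componentwise minimum.\<close>

definition trop_add :: "'n int_vec \<Rightarrow> 'n int_vec \<Rightarrow> 'n::finite int_vec" where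
  "trop_add a b = (\<chi> i. min (a $ i) (b $ i))"

definition is_trop_hom :: "('n::{finite,linorder} ipoly fract \<Rightarrow> 'n int_vec) \<Rightarrow> bool" where
  "is_trop_hom \<phi> \<longleftrightarrow>
     (\<forall>f\<in>subtraction_free. \<forall>g\<in>subtraction_free.
        \<phi> (f * g) = \<phi> f + \<phi> g \<and> \<phi> (f + g) = trop_add (\<phi> f) (\<phi> g)) \<and>
     (\<forall>i. \<phi> (y_var i) = axis i 1)"

text \<open>The following lemmas show that such a homomorphism exists and that its values on
  \<open>subtraction_free\<close> are unique; hence the choice in \<open>pi_trop\<close> below is harmless.\<close>

lemma nonneg_polys_lookup: "P \<in> nonneg_polys \<Longrightarrow> 0 \<le> Poly_Mapping.lookup P m"
  by (simp add: nonneg_polys_def)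

lemma lookup_mult_nonneg:
  fixes P Q :: "'n::linorder ipoly"
  assumes "\<And>m. 0 \<le> Poly_Mapping.lookup P m" "\<And>m. 0 \<le> Poly_Mapping.lookup Q m"
  shows "0 \<le> Poly_Mapping.lookup (P * Q) m"
  unfolding lookup_mult
  by (auto simp: Sum_any.expand_set when_def assms intro!: sum_nonneg mult_nonneg_nonneg)

lemma keys_add_nonneg:
  assumes "P \<in> nonneg_polys" "Q \<in> nonneg_polys"
  shows "Poly_Mapping.keys (P + Q) = Poly_Mapping.keys P \<union> Poly_Mapping.keys Q"
  using assms nonneg_polys_lookup[OF assms(1)] nonneg_polys_lookup[OF assms(2)]
  by (auto simp: in_keys_iff lookup_add add_nonneg_eq_0_iff)

lemma keys_mult_nonneg:
  fixes P Q :: "'n::linorder ipoly"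
  assumes P: "P \<in> nonneg_polys" and Q: "Q \<in> nonneg_polys"
  shows "Poly_Mapping.keys (P * Q) =
    {a + b | a b. a \<in> Poly_Mapping.keys P \<and> b \<in> Poly_Mapping.keys Q}"
proof (rule subset_antisym[OF keys_mult], safe)
  fix a b assume a: "a \<in> Poly_Mapping.keys P" and b: "b \<in> Poly_Mapping.keys Q"
  define R where "R = Poly_Mapping.single a (Poly_Mapping.lookup P a)"
  define S where "S = Poly_Mapping.single b (Poly_Mapping.lookup Q b)"
  have R: "0 \<le> Poly_Mapping.lookup R m" "0 \<le> Poly_Mapping.lookup (P - R) m" for m
    using nonneg_polys_lookup[OF P] by (auto simp: R_def lookup_single lookup_minus when_def)
  have S: "0 \<le> Poly_Mapping.lookup S m" "0 \<le> Poly_Mapping.lookup (Q - S) m" for m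
    using nonneg_polys_lookup[OF Q] by (auto simp: S_def lookup_single lookup_minus when_def)
  have eq: "P * Q = R * S + (R * (Q - S) + (P - R) * Q)"
    by (simp add: algebra_simps)
  have "0 < Poly_Mapping.lookup (R * S) (a + b)"
    using a b nonneg_polys_lookup[OF P, of a] nonneg_polys_lookup[OF Q, of b]
    by (auto simp: R_def S_def mult_single in_keys_iff)
  moreover have "0 \<le> Poly_Mapping.lookup (R * (Q - S)) (a + b)"
    by (rule lookup_mult_nonneg) (use R S in auto)
  moreover have "0 \<le> Poly_Mapping.lookup ((P - R) * Q) (a + b)"
    by (rule lookup_mult_nonneg) (use R nonneg_polys_lookup[OF Q] in auto)
  ultimately show "a + b \<in> Poly_Mapping.keys (P * Q)"
    by (simp add: eq in_keys_iff lookup_add)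
qed

lemma nonneg_polys_add: "P \<in> nonneg_polys \<Longrightarrow> Q \<in> nonneg_polys \<Longrightarrow> P + Q \<in> nonneg_polys"
proof -
  assume *: "P \<in> nonneg_polys" "Q \<in> nonneg_polys"
  then have "Poly_Mapping.keys (P + Q) \<noteq> {}"
    by (simp add: keys_add_nonneg) (simp add: nonneg_polys_def)
  with * show ?thesis
    by (auto simp: nonneg_polys_def lookup_add)
qed

lemma nonneg_polys_mult:
  fixes P Q :: "'n::linorder ipoly"
  shows "P \<in> nonneg_polys \<Longrightarrow> Q \<in> nonneg_polys \<Longrightarrow> P * Q \<in> nonneg_polys"
  by (auto simp: nonneg_polys_def intro: lookup_mult_nonneg)

lemma nonneg_polys_monom: "0 < c \<Longrightarrow> Poly_Mapping.single m c \<in> nonneg_polys"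
  by (auto simp: nonneg_polys_def lookup_single when_def dest: arg_cong[of _ _ "\<lambda>P. Poly_Mapping.lookup P m"])

lemma nonneg_polys_one: "1 \<in> nonneg_polys"
  using nonneg_polys_monom[of 1 0] by simp

definition min_exps :: "'n::{finite,linorder} ipoly \<Rightarrow> 'n int_vec" where
  "min_exps P = (\<chi> i. Min ((\<lambda>m. int (Poly_Mapping.lookup m i)) ` Poly_Mapping.keys P))"

lemma min_exps_add:
  assumes "P \<in> nonneg_polys" "Q \<in> nonneg_polys"
  shows "min_exps (P + Q) = trop_add (min_exps P) (min_exps Q)"
  using assms
  by (auto simp: min_exps_def trop_add_def keys_add_nonneg image_Un nonneg_polys_def vec_eq_iff
      intro!: Min_Un)

lemma min_exps_mult:
  assumes "P \<in> nonneg_polys" "Q \<in> nonneg_polys"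
  shows "min_exps (P * Q) = min_exps P + min_exps Q"
proof -
  have "Min ((\<lambda>m. int (Poly_Mapping.lookup m i)) ` Poly_Mapping.keys (P * Q)) =
    Min ((\<lambda>m. int (Poly_Mapping.lookup m i)) ` Poly_Mapping.keys P) +
    Min ((\<lambda>m. int (Poly_Mapping.lookup m i)) ` Poly_Mapping.keys Q)" (is "Min (?f ` _) = ?a + ?b") for i
  proof -
    have ne: "Poly_Mapping.keys P \<noteq> {}" "Poly_Mapping.keys Q \<noteq> {}"
      using assms by (auto simp: nonneg_polys_def)
    have "?a \<in> ?f ` Poly_Mapping.keys P" "?b \<in> ?f ` Poly_Mapping.keys Q"
      using ne by (auto intro!: Min_in)
    then obtain a b where "a \<in> Poly_Mapping.keys P" "b \<in> Poly_Mapping.keys Q" "?a = ?f a" "?b = ?f b"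
      by blast
    moreover have "?a \<le> ?f a'" if "a' \<in> Poly_Mapping.keys P" for a'
      using that by (auto intro: Min_le)
    moreover have "?b \<le> ?f b'" if "b' \<in> Poly_Mapping.keys Q" for b'
      using that by (auto intro: Min_le)
    moreover have "?f (a + b) = ?f a + ?f b" for a b
      by (simp add: lookup_add)
    ultimately show ?thesis
    proof (intro Min_eqI)
      fix e assume "e \<in> ?f ` Poly_Mapping.keys (P * Q)"
      then obtain a' b' where "a' \<in> Poly_Mapping.keys P" "b' \<in> Poly_Mapping.keys Q"
        "e = ?f a' + ?f b'"
        unfolding keys_mult_nonneg[OF assms] by (auto simp: lookup_add)
      then show "?a + ?b \<le> e"
        by (auto intro!: add_mono Min_le)
    next
      have "a + b \<in> Poly_Mapping.keys (P * Q)"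
        using \<open>a \<in> _\<close> \<open>b \<in> _\<close> unfolding keys_mult_nonneg[OF assms] by blast
      then have "?f (a + b) \<in> ?f ` Poly_Mapping.keys (P * Q)"
        by (rule imageI)
      then show "?a + ?b \<in> ?f ` Poly_Mapping.keys (P * Q)"
        using \<open>?a = ?f a\<close> \<open>?b = ?f b\<close> by (simp add: lookup_add)
    qed simp
  qed
  then show ?thesis by (simp add: min_exps_def vec_eq_iff)
qed

lemma is_trop_hom_exists: "\<exists>\<phi> :: 'n::{finite,linorder} ipoly fract \<Rightarrow> 'n int_vec. is_trop_hom \<phi>"
proof -
  define \<phi> :: "'n ipoly fract \<Rightarrow> 'n int_vec" where
    "\<phi> f = (SOME v. \<exists>P\<in>nonneg_polys. \<exists>Q\<in>nonneg_polys. f = Fract P Q \<and> v = min_exps P - min_exps Q)" for f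
  have \<phi>: "\<phi> (Fract P Q) = min_exps P - min_exps Q" if PQ: "P \<in> nonneg_polys" "Q \<in> nonneg_polys" for P Q
    unfolding \<phi>_def
  proof (rule some_equality)
    fix v assume "\<exists>P'\<in>nonneg_polys. \<exists>Q'\<in>nonneg_polys. Fract P Q = Fract P' Q' \<and> v = min_exps P' - min_exps Q'"
    then obtain P' Q' where *: "P' \<in> nonneg_polys" "Q' \<in> nonneg_polys" "Fract P Q = Fract P' Q'"
      and v: "v = min_exps P' - min_exps Q'" by blast
    then have "P * Q' = P' * Q"
      using PQ by (subst (asm) eq_fract) (auto simp: nonneg_polys_def)
    then have "min_exps P + min_exps Q' = min_exps P' + min_exps Q"
      using * PQ by (metis min_exps_mult)
    then show "v = min_exps P - min_exps Q"
      by (simp add: v algebra_simps)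
  qed (use PQ in blast)
  have "\<phi> (f * g) = \<phi> f + \<phi> g \<and> \<phi> (f + g) = trop_add (\<phi> f) (\<phi> g)"
    if "f \<in> subtraction_free" "g \<in> subtraction_free" for f g
  proof -
    obtain P Q R S where f: "f = Fract P Q" and g: "g = Fract R S"
      and N: "P \<in> nonneg_polys" "Q \<in> nonneg_polys" "R \<in> nonneg_polys" "S \<in> nonneg_polys"
      using \<open>f \<in> _\<close> \<open>g \<in> _\<close> unfolding subtraction_free_def by blast
    then have "Q \<noteq> 0" "S \<noteq> 0" by (auto simp: nonneg_polys_def)
    then show ?thesis
      using N unfolding f g
      by (simp add: \<phi> nonneg_polys_mult nonneg_polys_add min_exps_mult min_exps_add)
         (auto simp: trop_add_def vec_eq_iff)
  qed
  moreover have "\<phi> (y_var i) = axis i 1" for i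
    unfolding y_var_def
    by (subst \<phi>) (auto simp: nonneg_polys_monom nonneg_polys_one min_exps_def axis_def vec_eq_iff lookup_single when_def)
  ultimately show ?thesis
    unfolding is_trop_hom_def by blast
qed


lemma poly_subtraction_free: "P \<in> nonneg_polys \<Longrightarrow> Fract P 1 \<in> subtraction_free"
  unfolding subtraction_free_def using nonneg_polys_one by blast

lemma is_trop_hom_unique:
  fixes f :: "'n::{finite,linorder} ipoly fract"
  assumes \<phi>: "is_trop_hom \<phi>" and f: "f \<in> subtraction_free" and \<psi>: "is_trop_hom \<psi>"
  shows "\<phi> f = \<psi> f"
proof -
  have mult: "\<theta> (f * g) = \<theta> f + \<theta> g" and add: "\<theta> (f + g) = trop_add (\<theta> f) (\<theta> g)"
    if "is_trop_hom \<theta>" "f \<in> subtraction_free" "g \<in> subtraction_free"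
    for \<theta> :: "'n ipoly fract \<Rightarrow> 'n int_vec" and f g
    using that by (auto simp: is_trop_hom_def)
  have var: "\<theta> (y_var i) = axis i 1" if "is_trop_hom \<theta>" for \<theta> and i :: 'n
    using that by (auto simp: is_trop_hom_def)
  let ?M = "\<lambda>m. Fract (Poly_Mapping.single m 1) 1 :: 'n ipoly fract"
  have M: "?M m \<in> subtraction_free" for m
    by (simp add: poly_subtraction_free nonneg_polys_monom)
  have zero: "\<theta> (?M 0) = 0" if "is_trop_hom \<theta>" for \<theta>
    using mult[OF that M[of 0] M[of 0]] by simp
  have M_add: "?M (a + b) = ?M a * ?M b" for a b
    by (simp add: mult_single)
  have pow: "\<phi> (?M (Poly_Mapping.single i e)) = \<psi> (?M (Poly_Mapping.single i e))" for i e
  proof (induction e)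
    case 0
    then show ?case using zero[OF \<phi>] zero[OF \<psi>] by simp
  next
    case (Suc e)
    have "?M (Poly_Mapping.single i (Suc e)) = ?M (Poly_Mapping.single i e) * y_var i"
      unfolding y_var_def M_add[symmetric] by (simp flip: single_add)
    moreover have "y_var i \<in> subtraction_free"
      by (simp add: y_var_def M)
    ultimately show ?case
      using Suc mult M var \<phi> \<psi> by metis
  qed
  have monom: "\<phi> (?M m) = \<psi> (?M m)" for m
  proof (induction m rule: update_induct)
    case const
    then show ?case using zero[OF \<phi>] zero[OF \<psi>] by simp
  next
    case (update m a e)
    have "Poly_Mapping.update a e m = m + Poly_Mapping.single a e"
      using update(1) by (intro poly_mapping_eqI) (auto simp: lookup_update lookup_add lookup_single in_keys_iff when_def)
    then show ?case
      using update(3) pow mult[OF \<phi> M M] mult[OF \<psi> M M] by (metis M_add)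
  qed
  have scaled: "\<phi> (Fract (Poly_Mapping.single m (1 + int c)) 1) = \<psi> (Fract (Poly_Mapping.single m (1 + int c)) 1)" for m c
  proof (induction c)
    case 0
    then show ?case by (simp add: monom)
  next
    case (Suc c)
    have "Fract (Poly_Mapping.single m (1 + int (Suc c))) 1 = ?M m + Fract (Poly_Mapping.single m (1 + int c)) 1"
      by (simp flip: single_add)
    moreover have "Fract (Poly_Mapping.single m (1 + int c)) 1 \<in> subtraction_free"
      by (intro poly_subtraction_free nonneg_polys_monom) simp
    ultimately show ?case
      using Suc monom add M \<phi> \<psi> by metis
  qed
  have poly: "P \<in> nonneg_polys \<Longrightarrow> \<phi> (Fract P 1) = \<psi> (Fract P 1)" for P
  proof (induction P rule: update_induct)
    case const
    then show ?case by (simp add: nonneg_polys_def)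
  next
    case (update P m c)
    have eq: "Poly_Mapping.update m c P = P + Poly_Mapping.single m c"
      using update(1) by (intro poly_mapping_eqI) (auto simp: lookup_update lookup_add lookup_single in_keys_iff when_def)
    have "0 < c"
      using nonneg_polys_lookup[OF update.prems, of m] update(2) by (simp add: lookup_update)
    then have c: "\<phi> (Fract (Poly_Mapping.single m c) 1) = \<psi> (Fract (Poly_Mapping.single m c) 1)"
      using scaled[of m "nat (c - 1)"] by simp
    show ?case
    proof (cases "P = 0")
      case True
      then show ?thesis using eq c by simp
    next
      case False
      have "0 \<le> Poly_Mapping.lookup P m'" for m'
        using nonneg_polys_lookup[OF update.prems, of m'] update(1)
        by (auto simp: lookup_update in_keys_iff split: if_splits)
      with False have P: "P \<in> nonneg_polys" by (simp add: nonneg_polys_def)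
      have "Fract (Poly_Mapping.update m c P) 1 = Fract P 1 + Fract (Poly_Mapping.single m c) 1"
        by (simp add: eq)
      then show ?thesis
        using update(3)[OF P] c add poly_subtraction_free[OF P]
          poly_subtraction_free[OF nonneg_polys_monom[OF \<open>0 < c\<close>]] \<phi> \<psi> by metis
    qed
  qed
  obtain P Q where PQ: "f = Fract P Q" "P \<in> nonneg_polys" "Q \<in> nonneg_polys"
    using f unfolding subtraction_free_def by blast
  then have "f * Fract Q 1 = Fract P 1"
    by (auto simp: eq_fract nonneg_polys_def)
  then have quot: "\<theta> f = \<theta> (Fract P 1) - \<theta> (Fract Q 1)" if "is_trop_hom \<theta>" for \<theta>
    using mult[OF that f poly_subtraction_free[OF PQ(3)]] by simp
  show ?thesis
    unfolding quot[OF \<phi>] quot[OF \<psi>] poly[OF PQ(2)] poly[OF PQ(3)] ..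
qed

definition pi_trop :: "'n::{finite,linorder} ipoly fract \<Rightarrow> 'n int_vec" where
  "pi_trop = (SOME \<phi>. is_trop_hom \<phi>)"

definition tropical_sign_sequence ::
  "'n::{finite,linorder} int_mat \<Rightarrow> (nat \<Rightarrow> 'n) \<Rightarrow> nat \<Rightarrow> (nat \<Rightarrow> int) \<Rightarrow> bool" where
  "tropical_sign_sequence B k T \<epsilon> \<longleftrightarrow>
     (\<forall>s<T. let c = pi_trop (y_seq B k s (k s)) in
        c \<noteq> 0 \<and> (\<epsilon> s = 1 \<and> (\<forall>i. 0 \<le> c $ i) \<or> \<epsilon> s = - 1 \<and> (\<forall>i. c $ i \<le> 0)))"


section \<open>Signed mutations\<close>

type_synonym 'n phase = "(real^'n) \<times> (real^'n)"

text \<open>This is \<open>Li2 (- x) = - \<integral>\<^sub>0\<^sup>x log (1 + z) / z dz\<close>; only meant for arguments \<open>w \<le> 0\<close>.\<close>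

definition Li2 :: "real \<Rightarrow> real" where
  "Li2 w = - integral {0..- w} (\<lambda>z. ln (1 + z) / z)"

definition y_coord :: "'n::finite int_mat \<Rightarrow> ('n \<Rightarrow> int) \<Rightarrow> 'n \<Rightarrow> 'n phase \<Rightarrow> real" where
  "y_coord B d i = (\<lambda>(u, p). exp (of_int (d i) * p $ i + (\<Sum>j\<in>UNIV. of_int (B $ j $ i) * u $ j)))"

definition hamiltonian ::
  "'n::finite int_mat \<Rightarrow> ('n \<Rightarrow> int) \<Rightarrow> 'n \<Rightarrow> int \<Rightarrow> 'n phase \<Rightarrow> real" where
  "hamiltonian B d k \<epsilon> x =
     of_int \<epsilon> / (2 * of_int (d k)) * Li2 (- (y_coord B d k x powi \<epsilon>))"

definition vec_upd :: "real^'n \<Rightarrow> 'n::finite \<Rightarrow> real \<Rightarrow> real^'n" where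
  "vec_upd v i a = (\<chi> j. if j = i then a else v $ j)"

definition partial_u :: "('n::finite phase \<Rightarrow> real) \<Rightarrow> 'n \<Rightarrow> 'n phase \<Rightarrow> real" where
  "partial_u H i = (\<lambda>(u, p). deriv (\<lambda>a. H (vec_upd u i a, p)) (u $ i))"

definition partial_p :: "('n::finite phase \<Rightarrow> real) \<Rightarrow> 'n \<Rightarrow> 'n phase \<Rightarrow> real" where
  "partial_p H i = (\<lambda>(u, p). deriv (\<lambda>a. H (u, vec_upd p i a)) (p $ i))"

definition hamilton_eqs ::
  "('n::finite phase \<Rightarrow> real) \<Rightarrow> (real \<Rightarrow> 'n phase) \<Rightarrow> real set \<Rightarrow> bool" where
  "hamilton_eqs H \<gamma> I \<longleftrightarrow> (\<forall>t\<in>I. \<forall>i.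
     ((\<lambda>t. fst (\<gamma> t) $ i) has_real_derivative partial_p H i (\<gamma> t)) (at t within I) \<and>
     ((\<lambda>t. snd (\<gamma> t) $ i) has_real_derivative - partial_u H i (\<gamma> t)) (at t within I))"

definition time_one_flow :: "('n::finite phase \<Rightarrow> real) \<Rightarrow> 'n phase \<Rightarrow> 'n phase" where
  "time_one_flow H x = (THE x'. \<exists>\<gamma>. hamilton_eqs H \<gamma> {0..1} \<and> \<gamma> 0 = x \<and> \<gamma> 1 = x')"

definition rho :: "'n::finite int_mat \<Rightarrow> ('n \<Rightarrow> int) \<Rightarrow> 'n \<Rightarrow> int \<Rightarrow> 'n phase \<Rightarrow> 'n phase" where
  "rho B d k \<epsilon> = time_one_flow (hamiltonian B d k \<epsilon>)"

definition tau :: "'n::finite int_mat \<Rightarrow> 'n \<Rightarrow> int \<Rightarrow> 'n phase \<Rightarrow> 'n phase" where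
  "tau B k \<epsilon> = (\<lambda>(u, p).
     (\<chi> i. if i = k then - u $ k + (\<Sum>j\<in>UNIV. of_int (pos_part (- \<epsilon> * B $ j $ k)) * u $ j)
           else u $ i,
      \<chi> i. if i = k then - p $ k else p $ i + of_int (pos_part (- \<epsilon> * B $ i $ k)) * p $ k))"

definition signed_mutation ::
  "'n::finite int_mat \<Rightarrow> ('n \<Rightarrow> int) \<Rightarrow> 'n \<Rightarrow> int \<Rightarrow> 'n phase \<Rightarrow> 'n phase" where
  "signed_mutation B d k \<epsilon> = tau B k \<epsilon> \<circ> rho B d k \<epsilon>"


section \<open>Hamiltonian flow, Lagrangian and action\<close>

definition hamiltonian_at ::
  "'n::finite int_mat \<Rightarrow> ('n \<Rightarrow> int) \<Rightarrow> (nat \<Rightarrow> 'n) \<Rightarrow> (nat \<Rightarrow> int) \<Rightarrow> nat \<Rightarrow> 'n phase \<Rightarrow> real" where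
  "hamiltonian_at B d k \<epsilon> s = hamiltonian (B_seq B k s) d (k s) (\<epsilon> s)"

text \<open>\<open>\<gamma> s\<close> is the part of the flow over the time span \<open>[s, s + 1]\<close>, written in the \<open>s\<close>-th
  canonical coordinates, and \<open>x s\<close> is the point \<open>(u[s], p[s])\<close>. As \<open>rho\<close> is the time one flow, the last
  conjunct amounts to \<open>x (Suc s)\<close> being the image of \<open>x s\<close> under the signed mutation.\<close>

definition hamiltonian_flow ::
  "'n::finite int_mat \<Rightarrow> ('n \<Rightarrow> int) \<Rightarrow> (nat \<Rightarrow> 'n) \<Rightarrow> (nat \<Rightarrow> int) \<Rightarrow> nat \<Rightarrow>
     (nat \<Rightarrow> 'n phase) \<Rightarrow> (nat \<Rightarrow> real \<Rightarrow> 'n phase) \<Rightarrow> bool" where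
  "hamiltonian_flow B d k \<epsilon> T x \<gamma> \<longleftrightarrow> (\<forall>s<T.
     \<gamma> s (real s) = x s \<and>
     hamilton_eqs (hamiltonian_at B d k \<epsilon> s) (\<gamma> s) {real s..real s + 1} \<and>
     x (Suc s) = tau (B_seq B k s) (k s) (\<epsilon> s) (\<gamma> s (real s + 1)))"

text \<open>The velocity is the actual time derivative along the trajectory (one-sided at the
  endpoints of the time span).\<close>

definition lagrangian ::
  "'n::finite int_mat \<Rightarrow> ('n \<Rightarrow> int) \<Rightarrow> (nat \<Rightarrow> 'n) \<Rightarrow> (nat \<Rightarrow> int) \<Rightarrow>
     (nat \<Rightarrow> real \<Rightarrow> 'n phase) \<Rightarrow> nat \<Rightarrow> real \<Rightarrow> real" where
  "lagrangian B d k \<epsilon> \<gamma> s t =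
     vector_derivative (\<lambda>t. fst (\<gamma> s t) $ k s) (at t within {real s..real s + 1})
       * snd (\<gamma> s t) $ k s
     - hamiltonian_at B d k \<epsilon> s (\<gamma> s t)"

definition action ::
  "'n::finite int_mat \<Rightarrow> ('n \<Rightarrow> int) \<Rightarrow> (nat \<Rightarrow> 'n) \<Rightarrow> (nat \<Rightarrow> int) \<Rightarrow> nat \<Rightarrow>
     (nat \<Rightarrow> real \<Rightarrow> 'n phase) \<Rightarrow> real" where
  "action B d k \<epsilon> T \<gamma> =
     (\<Sum>s<T. integral {real s..real s + 1} (lagrangian B d k \<epsilon> \<gamma> s))"

end

theory Submission
  imports Defs
begin

text \<open>The Hamiltonian for the direction \<open>k\<close> is a function of \<open>y\<^sub>k\<close> alone, hence it depends only on
  the momentum \<open>p\<^sub>k\<close> and the linear form \<open>w\<^sub>k = \<Sum>\<^sub>j b\<^sub>j\<^sub>k u\<^sub>j\<close>. Matrix mutation preserves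
  skew-symmetrizability, so \<open>b\<^sub>k\<^sub>k = 0\<close> at every step of the sequence and \<open>w\<^sub>k\<close> does not involve
  \<open>u\<^sub>k\<close>. Two things follow. The Hamiltonian is independent of \<open>u\<^sub>k\<close>, so \<open>p\<^sub>k\<close> does not move; and
  it is independent of every \<open>p\<^sub>j\<close> with \<open>j \<noteq> k\<close>, so \<open>u\<^sub>k\<close> is the only position that moves, and
  \<open>w\<^sub>k\<close> does not move either. Both invariants together determine \<open>y\<^sub>k\<close>, the value of the Hamiltonian,
  and the velocity \<open>\<partial>H/\<partial>p\<^sub>k\<close> of \<open>u\<^sub>k\<close>; so the Lagrangian is a function of two constants of
  motion. This is the content of \<open>conserved_momentum_and_form\<close> and
  \<open>lagrangian_constant_on_segment\<close>.

  As each time span has length one, the action is the sum of these constant values.\<close>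


section \<open>Skew-symmetrizability along a mutation sequence\<close>

lemma skew_symmetrizer_diagonal_zero:
  assumes "skew_symmetrizer d B"
  shows "B $ i $ i = 0"
proof -
  have "0 < d i" "d i * B $ i $ i = - (d i * B $ i $ i)"
    using assms unfolding skew_symmetrizer_def by blast+
  then have "d i * B $ i $ i = 0" by linarith
  then show ?thesis using \<open>0 < d i\<close> by simp
qed

text \<open>The correction term \<open>[-x]\<^sub>+ y + x [y]\<^sub>+\<close> of a mutation equals \<open>\<plusminus>x y\<close> when \<open>x\<close> and \<open>y\<close> have
  the same sign (plus for nonnegative, minus for negative) and vanishes otherwise. Transposition
  turns \<open>(x, y)\<close> into \<open>(y', x')\<close>, where \<open>x'\<close> and \<open>y'\<close> have the signs opposite to those of \<open>x\<close>
  and \<open>y\<close>; so it preserves the dichotomy and exchanges plus and minus, while the rescaled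
  products \<open>a x y\<close> and \<open>c y' x'\<close> agree.\<close>

lemma mutation_correction_skew:
  fixes a b c :: int
  assumes pos: "0 < a" "0 < b" "0 < c"
    and x: "a * x = - (b * x')" and y: "b * y = - (c * y')"
  shows "a * (pos_part (- x) * y + x * pos_part y)
    = - (c * (pos_part (- y') * x' + y' * pos_part x'))"
proof -
  have "0 \<le> x \<longleftrightarrow> 0 \<le> a * x" "x' \<le> 0 \<longleftrightarrow> b * x' \<le> 0"
    "0 \<le> y \<longleftrightarrow> 0 \<le> b * y" "y' \<le> 0 \<longleftrightarrow> c * y' \<le> 0"
    using pos by (simp_all add: zero_le_mult_iff mult_le_0_iff)
  then have signs: "x' \<le> 0 \<longleftrightarrow> 0 \<le> x" "y' \<le> 0 \<longleftrightarrow> 0 \<le> y"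
    using x y by auto
  have "a * x * y = - (b * y) * x'" using x by simp
  then have product: "a * (x * y) = c * (y' * x')" using y by simp
  have correction: "pos_part (- v) * w + v * pos_part w
      = (if 0 \<le> v \<and> 0 \<le> w then v * w else if v < 0 \<and> w < 0 then - (v * w) else 0)" for v w
    by (auto simp: pos_part_def max_def)
  have transposed: "pos_part (- y') * x' + y' * pos_part x'
      = (if 0 \<le> x \<and> 0 \<le> y then - (y' * x') else if x < 0 \<and> y < 0 then y' * x' else 0)"
    using signs by (auto simp: pos_part_def max_def)
  show ?thesis
    unfolding correction[of x y] transposed using product by simp
qed

lemma skew_symmetrizer_mutate:
  assumes "skew_symmetrizer d B"
  shows "skew_symmetrizer d (mutate 1 k B)"
proof -
  have pos: "0 < d i" and skew: "d i * B $ i $ j = - (d j * B $ j $ i)" for i j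
    using assms unfolding skew_symmetrizer_def by blast+
  have mutated: "d i * (B $ i $ j + pos_part (- B $ i $ k) * B $ k $ j + B $ i $ k * pos_part (B $ k $ j))
    = - (d j * (B $ j $ i + pos_part (- B $ j $ k) * B $ k $ i + B $ j $ k * pos_part (B $ k $ i)))"
    for i j
    using mutation_correction_skew[OF pos pos pos skew[of i k] skew[of k j]] skew[of i j]
    by (simp only: distrib_left add.assoc minus_add_distrib)
  show ?thesis
    unfolding skew_symmetrizer_def
  proof (intro conjI allI)
    fix i j
    show "d i * mutate 1 k B $ i $ j = - (d j * mutate 1 k B $ j $ i)"
      using skew[of i j] mutated[of i j] by (simp add: mutate_def)
  qed (rule pos)
qed

lemma skew_symmetrizer_B_seq:
  "skew_symmetrizer d B \<Longrightarrow> skew_symmetrizer d (B_seq B k s)"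
  by (induction s) (auto intro: skew_symmetrizer_mutate)


section \<open>Constants of motion\<close>

lemma vec_upd_nth [simp]: "vec_upd v i a $ j = (if j = i then a else v $ j)"
  by (simp add: vec_upd_def)

lemma partial_u_cyclic:
  assumes H: "\<And>u p. H (u, p) = h (p $ k) (\<Sum>j\<in>UNIV. c j * u $ j)" and "c k = 0"
  shows "partial_u H k x = 0"
proof -
  obtain u p where x: "x = (u, p)" by (cases x)
  have "(\<Sum>j\<in>UNIV. c j * vec_upd u k a $ j) = (\<Sum>j\<in>UNIV. c j * u $ j)" for a
    using \<open>c k = 0\<close> by (intro sum.cong) auto
  then show ?thesis
    unfolding x partial_u_def by (simp add: H del: vec_upd_nth)
qed

lemma partial_p_single_momentum:
  assumes H: "\<And>u p. H (u, p) = h (p $ k) (\<Sum>j\<in>UNIV. c j * u $ j)"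
  shows "partial_p H i (u, p) =
    (if i = k then deriv (\<lambda>a. h a (\<Sum>j\<in>UNIV. c j * u $ j)) (p $ k) else 0)"
  by (auto simp: partial_p_def H)

text \<open>A Hamiltonian that depends on a single momentum \<open>p\<^sub>k\<close> moves only the position \<open>u\<^sub>k\<close>; a
  linear form in the positions in which \<open>u\<^sub>k\<close> does not occur is then conserved, and so is
  \<open>p\<^sub>k\<close> because \<open>u\<^sub>k\<close> is a cyclic coordinate.\<close>

lemma conserved_momentum_and_form:
  assumes H: "\<And>u p. H (u, p) = h (p $ k) (\<Sum>j\<in>UNIV. c j * u $ j)" and "c k = 0"
    and flow: "hamilton_eqs H \<gamma> I" and "convex I"
  obtains P W where "\<And>t. t \<in> I \<Longrightarrow> snd (\<gamma> t) $ k = P"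
    and "\<And>t. t \<in> I \<Longrightarrow> (\<Sum>j\<in>UNIV. c j * fst (\<gamma> t) $ j) = W"
proof -
  have "((\<lambda>t. snd (\<gamma> t) $ k) has_real_derivative 0) (at t within I)" if "t \<in> I" for t
  proof -
    have "((\<lambda>t. snd (\<gamma> t) $ k) has_real_derivative - partial_u H k (\<gamma> t)) (at t within I)"
      using flow that by (simp add: hamilton_eqs_def)
    then show ?thesis
      by (simp add: partial_u_cyclic[where H = H and h = h and k = k and c = c, OF H \<open>c k = 0\<close>])
  qed
  then have "\<exists>P. \<forall>t\<in>I. snd (\<gamma> t) $ k = P"
    by (intro has_field_derivative_zero_constant[OF \<open>convex I\<close>])
  then obtain P where P: "\<And>t. t \<in> I \<Longrightarrow> snd (\<gamma> t) $ k = P"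
    by blast
  have "((\<lambda>t. \<Sum>j\<in>UNIV. c j * fst (\<gamma> t) $ j) has_real_derivative 0) (at t within I)"
    if "t \<in> I" for t
  proof -
    have "((\<lambda>t. \<Sum>j\<in>UNIV. c j * fst (\<gamma> t) $ j) has_real_derivative
        (\<Sum>j\<in>UNIV. c j * partial_p H j (\<gamma> t))) (at t within I)"
      using flow that unfolding hamilton_eqs_def
      by (intro DERIV_sum DERIV_cmult) auto
    moreover have "c j * partial_p H j (\<gamma> t) = 0" for j
      using \<open>c k = 0\<close> partial_p_single_momentum[where H = H and h = h and k = k and c = c, OF H,
          of j "fst (\<gamma> t)" "snd (\<gamma> t)"] by auto
    ultimately show ?thesis by simp
  qed
  then have "\<exists>W. \<forall>t\<in>I. (\<Sum>j\<in>UNIV. c j * fst (\<gamma> t) $ j) = W"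
    by (intro has_field_derivative_zero_constant[OF \<open>convex I\<close>])
  then obtain W where W: "\<And>t. t \<in> I \<Longrightarrow> (\<Sum>j\<in>UNIV. c j * fst (\<gamma> t) $ j) = W"
    by blast
  show ?thesis using that[OF P W] .
qed


section \<open>The Lagrangian and the action\<close>

lemma lagrangian_constant_on_segment:
  assumes flow: "hamilton_eqs (hamiltonian_at B d k \<epsilon> s) (\<gamma> s) {real s..real s + 1}"
    and diag: "B_seq B k s $ k s $ k s = 0"
  obtains L where "\<And>t. t \<in> {real s..real s + 1} \<Longrightarrow> lagrangian B d k \<epsilon> \<gamma> s t = L"
proof -
  let ?I = "{real s..real s + 1}" and ?H = "hamiltonian_at B d k \<epsilon> s"
  define c where "c j = real_of_int (B_seq B k s $ j $ k s)" for j
  define h where "h a w = of_int (\<epsilon> s) / (2 * of_int (d (k s)))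
      * Li2 (- (exp (of_int (d (k s)) * a + w) powi \<epsilon> s))" for a w :: real
  have H: "?H (u, p) = h (p $ k s) (\<Sum>j\<in>UNIV. c j * u $ j)" for u p
    by (simp add: hamiltonian_at_def hamiltonian_def y_coord_def h_def c_def)
  have "c (k s) = 0" by (simp add: c_def diag)
  then obtain P W where P: "\<And>t. t \<in> ?I \<Longrightarrow> snd (\<gamma> s t) $ k s = P"
    and W: "\<And>t. t \<in> ?I \<Longrightarrow> (\<Sum>j\<in>UNIV. c j * fst (\<gamma> s t) $ j) = W"
    using conserved_momentum_and_form[where H = ?H and h = h and k = "k s" and c = c,
        OF H _ flow convex_real_interval(5)] by blast
  have "lagrangian B d k \<epsilon> \<gamma> s t = deriv (\<lambda>a. h a W) P * P - h P W" if t: "t \<in> ?I" for t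
  proof -
    have "((\<lambda>t. fst (\<gamma> s t) $ k s) has_vector_derivative partial_p ?H (k s) (\<gamma> s t)) (at t within ?I)"
      using flow t by (simp add: hamilton_eqs_def has_real_derivative_iff_has_vector_derivative)
    then have "vector_derivative (\<lambda>t. fst (\<gamma> s t) $ k s) (at t within ?I)
        = partial_p ?H (k s) (\<gamma> s t)"
      using t by (intro vector_derivative_within_closed_interval) auto
    also have "\<dots> = deriv (\<lambda>a. h a W) P"
      using partial_p_single_momentum[where H = ?H and h = h and k = "k s" and c = c, OF H,
          of "k s" "fst (\<gamma> s t)" "snd (\<gamma> s t)"] P[OF t] W[OF t]
      by simp
    finally show ?thesis
      using H[of "fst (\<gamma> s t)" "snd (\<gamma> s t)"] P[OF t] W[OF t] by (simp add: lagrangian_def)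
  qed
  then show ?thesis using that by blast
qed

theorem proposition6p2:
  fixes B :: "'n::{finite,linorder} int_mat"
    and d :: "'n \<Rightarrow> int"
    and T :: nat
    and k :: "nat \<Rightarrow> 'n"
    and \<epsilon> :: "nat \<Rightarrow> int"
    and x :: "nat \<Rightarrow> 'n phase"
    and \<gamma> :: "nat \<Rightarrow> real \<Rightarrow> 'n phase"
  assumes "skew_symmetrizer d B"
    and "tropical_sign_sequence B k T \<epsilon>"
    and "\<And>s. s < T \<Longrightarrow> x (Suc s) = signed_mutation (B_seq B k s) d (k s) (\<epsilon> s) (x s)"
    and "hamiltonian_flow B d k \<epsilon> T x \<gamma>"
  shows "\<exists>L :: nat \<Rightarrow> real.
    (\<forall>s<T. \<forall>t\<in>{real s..real s + 1}. lagrangian B d k \<epsilon> \<gamma> s t = L s) \<and>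
    action B d k \<epsilon> T \<gamma> = (\<Sum>s<T. L s)"
proof -
  have "\<exists>l. \<forall>t\<in>{real s..real s + 1}. lagrangian B d k \<epsilon> \<gamma> s t = l" if "s < T" for s
  proof -
    have "hamilton_eqs (hamiltonian_at B d k \<epsilon> s) (\<gamma> s) {real s..real s + 1}"
      using assms(4) that by (simp add: hamiltonian_flow_def)
    moreover have "B_seq B k s $ k s $ k s = 0"
      using assms(1) by (blast intro: skew_symmetrizer_diagonal_zero skew_symmetrizer_B_seq)
    ultimately show ?thesis
      by (rule lagrangian_constant_on_segment) blast
  qed
  then obtain L where L: "\<forall>s<T. \<forall>t\<in>{real s..real s + 1}. lagrangian B d k \<epsilon> \<gamma> s t = L s"
    by metis
  have "integral {real s..real s + 1} (lagrangian B d k \<epsilon> \<gamma> s) = L s" if "s < T" for s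
  proof -
    have "integral {real s..real s + 1} (lagrangian B d k \<epsilon> \<gamma> s)
        = integral {real s..real s + 1} (\<lambda>_. L s)"
      using L that by (intro integral_cong) auto
    then show ?thesis by simp
  qed
  then have "action B d k \<epsilon> T \<gamma> = (\<Sum>s<T. L s)"
    by (simp add: action_def)
  with L show ?thesis by blast
qed

end
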